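(* For every integer $n \ge 3$, $R(Q_n,Q_n) \ge 2n+1$. That is, for every $n\ge 3$ there is a coloring of the elements of $Q_{2n}$ (the subsets of $[2n]$) with two colors such that no copy of $Q_n$ is monochromatic.
   Context: $Q_n$ denotes the poset of all subsets of $[n]=\{1,\dots,n\}$ ordered by inclusion. A poset embedding $f:2^{[n]}\to 2^{[m]}$ is an injective map with $S\subseteq T \iff f(S)\subseteq f(T)$ for all $S,T\subseteq[n]$; its image is called a copy of $Q_n$ (or of $2^{[n]}$) in $Q_m$. The cube Ramsey number $R(Q_n,Q_n)$ is the least integer $m$ such that every 2-coloring of the elements (vertices, i.e. subsets of $[m]$) of $Q_m$ admits a monochromatic copy of $Q_n$. *)

theory Defs
  imports "HOL-Library.FuncSet"
begin

definition cube :: "nat \<Rightarrow> nat set set" where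
  "cube n = Pow {1..n}"

definition cube_embedding :: "nat \<Rightarrow> nat \<Rightarrow> (nat set \<Rightarrow> nat set) \<Rightarrow> bool" where
  "cube_embedding n m f \<longleftrightarrow>
     f \<in> cube n \<rightarrow> cube m \<and> inj_on f (cube n) \<and>
     (\<forall>S\<in>cube n. \<forall>T\<in>cube n. S \<subseteq> T \<longleftrightarrow> f S \<subseteq> f T)"

definition cube_copy :: "nat \<Rightarrow> nat \<Rightarrow> nat set set \<Rightarrow> bool" where
  "cube_copy n m C \<longleftrightarrow> (\<exists>f. cube_embedding n m f \<and> C = f ` cube n)"

(* A 2-coloring of Q_m is a function nat set => bool; only its values on cube m
   matter, because every copy of Q_n in Q_m is a subset of cube m. *)
definition monochromatic :: "(nat set \<Rightarrow> bool) \<Rightarrow> nat set set \<Rightarrow> bool" where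
  "monochromatic c C \<longleftrightarrow> (\<exists>b. \<forall>S\<in>C. c S = b)"

definition cube_arrows :: "nat \<Rightarrow> nat \<Rightarrow> bool" where
  "cube_arrows m n \<longleftrightarrow>
     (\<forall>c :: nat set \<Rightarrow> bool. \<exists>C. cube_copy n m C \<and> monochromatic c C)"

definition cube_ramsey :: "nat \<Rightarrow> nat" where
  "cube_ramsey n = (LEAST m. cube_arrows m n)"

(* LEAST is only meaningful if some m satisfies the predicate. The block argument below
   shows that m = n^2 + 2n always does, so cube_ramsey is the intended minimum. *)
lemma cube_arrows_block: "cube_arrows (n + n * (n + 1)) n"
  unfolding cube_arrows_def
proof
  fix c :: "nat set \<Rightarrow> bool"
  let ?m = "n + n * (n + 1)"
  define h where "h S T = S \<union> {n + 1..n + n * card S} \<union> (\<lambda>i. n + n * card S + i) ` T"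
    for S T :: "nat set"
  have card_le: "card S \<le> n" if "S \<in> cube n" for S
    using that card_mono[of "{1..n}" S] by (auto simp: cube_def)
  have h_in: "h S T \<in> cube ?m" if S: "S \<in> cube n" and T: "T \<in> cube n" for S T
  proof -
    have le: "n * card S \<le> n * n"
      using card_le[OF S] by simp
    have bound: "x \<in> {1..?m}" if "1 \<le> x" "x \<le> n + n * card S + n" for x
      using that le unfolding atLeastAtMost_iff add_mult_distrib2 by linarith
    have "x \<in> {1..?m}" if x: "x \<in> h S T" for x
    proof -
      consider "x \<in> S" | "x \<in> {n + 1..n + n * card S}" | i where "i \<in> T" "x = n + n * card S + i"
        using x unfolding h_def by blast
      then show ?thesis
      proof cases
        case 1
        then have "x \<in> {1..n}" using S by (auto simp: cube_def)
        then show ?thesis by auto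
      next
        case 2
        then show ?thesis by (intro bound) auto
      next
        case 3
        then have "i \<in> {1..n}" using T by (auto simp: cube_def)
        then show ?thesis using 3 by (intro bound) auto
      qed
    qed
    then show ?thesis unfolding cube_def by blast
  qed
  have h_low: "h S T \<inter> {1..n} = S" if "S \<in> cube n" "T \<in> cube n" for S T
    using that by (fastforce simp: h_def cube_def)
  show "\<exists>C. cube_copy n ?m C \<and> monochromatic c C"
  proof (cases "\<exists>S\<in>cube n. \<forall>T\<in>cube n. \<not> c (h S T)")
    case True
    then obtain S where S: "S \<in> cube n" and red: "\<And>T. T \<in> cube n \<Longrightarrow> \<not> c (h S T)"
      by blast
    have high: "T = {i \<in> {1..n}. n + n * card S + i \<in> h S T}" if "T \<in> cube n" for T
      using that S by (fastforce simp: h_def cube_def)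
    have sub: "T \<subseteq> T' \<longleftrightarrow> h S T \<subseteq> h S T'" if T: "T \<in> cube n" and T': "T' \<in> cube n" for T T'
    proof
      assume "T \<subseteq> T'"
      then show "h S T \<subseteq> h S T'" by (auto simp: h_def)
    next
      assume "h S T \<subseteq> h S T'"
      then show "T \<subseteq> T'"
        by (subst high[OF T], subst high[OF T']) blast
    qed
    have "inj_on (h S) (cube n)"
      using sub by (intro inj_onI) blast
    then have "cube_embedding n ?m (h S)"
      unfolding cube_embedding_def using sub h_in[OF S] by blast
    then have "cube_copy n ?m (h S ` cube n)"
      unfolding cube_copy_def by blast
    moreover have "monochromatic c (h S ` cube n)"
      unfolding monochromatic_def using red by blast
    ultimately show ?thesis by blast
  next
    case False
    then obtain t where t: "\<And>S. S \<in> cube n \<Longrightarrow> t S \<in> cube n \<and> c (h S (t S))"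
      by metis
    define f where "f S = h S (t S)" for S
    have mono: "f S \<subseteq> f S'" if S: "S \<in> cube n" and S': "S' \<in> cube n" and "S \<subseteq> S'" for S S'
    proof (cases "S = S'")
      case False
      have "finite S'" using S' by (auto simp: cube_def intro: finite_subset)
      then have "card S < card S'"
        using False \<open>S \<subseteq> S'\<close> by (simp add: psubset_card_mono psubset_eq)
      then have "n * Suc (card S) \<le> n * card S'"
        by (intro mult_le_mono2) simp
      then have le: "n * card S + n \<le> n * card S'" by simp
      have "t S \<subseteq> {1..n}" using t[OF S] by (auto simp: cube_def)
      then have "(\<lambda>i. n + n * card S + i) ` t S \<subseteq> {n + 1..n + n * card S'}"
        using le by fastforce
      moreover have "{n + 1..n + n * card S} \<subseteq> {n + 1..n + n * card S'}"
        using le by (intro atLeastatMost_subset_iff[THEN iffD2] disjI2 conjI order_refl) linarith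
      ultimately show ?thesis
        using \<open>S \<subseteq> S'\<close> unfolding f_def h_def by (intro Un_least) (simp_all add: le_supI1 le_supI2)
    qed simp
    have low: "f S \<inter> {1..n} = S" if "S \<in> cube n" for S
      unfolding f_def using h_low t that by simp
    have sub: "S \<subseteq> S' \<longleftrightarrow> f S \<subseteq> f S'" if "S \<in> cube n" "S' \<in> cube n" for S S'
      using mono[OF that] low[OF that(1)] low[OF that(2)] Int_mono[of "f S" "f S'" "{1..n}" "{1..n}"]
      by auto
    have "inj_on f (cube n)"
      using low by (intro inj_on_inverseI[where g = "\<lambda>A. A \<inter> {1..n}"])
    moreover have "f \<in> cube n \<rightarrow> cube ?m"
      unfolding f_def using h_in t by simp
    ultimately have "cube_embedding n ?m f"
      unfolding cube_embedding_def using sub by blast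
    then have "cube_copy n ?m (f ` cube n)"
      unfolding cube_copy_def by blast
    moreover have "monochromatic c (f ` cube n)"
      unfolding monochromatic_def f_def using t by blast
    ultimately show ?thesis by blast
  qed
qed

end

theory Submission
  imports Defs
begin

text \<open>Colour the layers \<open>1, \<dots>, n - 1\<close> and \<open>2n\<close> blue, the layers \<open>0\<close> and \<open>n + 1, \<dots>, 2n - 1\<close>
  red, and the middle layer by a predicate \<open>P\<close>. A blue copy of \<open>Q\<^sub>n\<close> meets all \<open>n + 1\<close> layers
  containing blue sets, which forces its coatoms to be \<open>n\<close> of the \<open>n\<close>-subsets of some
  \<open>(n + 1)\<close>-set; taking complements, a red copy gives \<open>n\<close> red \<open>n\<close>-sets above some \<open>(n - 1)\<close>-set.
  Both are avoided by identifying \<open>[2n]\<close> with the group \<open>\<int>/n \<times> \<int>/2\<close> and colouring an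
  \<open>n\<close>-set according to whether its sum lies in an \<open>n\<close>-element set \<open>B\<close>: the \<open>n + 1\<close> subsets of
  \<open>Z\<close> have distinct sums, so at least one of them is red, and if only one is red then \<open>Z\<close> is a
  translate of \<open>-B\<close> plus one point, which a suitable choice of the sum of \<open>B\<close> excludes.\<close>

section \<open>Cube embeddings: sizes of images and complements\<close>

lemma cube_finite: "S \<in> cube n \<Longrightarrow> finite S"
  by (auto simp: cube_def intro: finite_subset)

lemma cube_embedding_subset_iff:
  "cube_embedding n m f \<Longrightarrow> S \<in> cube n \<Longrightarrow> T \<in> cube n \<Longrightarrow> f S \<subseteq> f T \<longleftrightarrow> S \<subseteq> T"
  by (simp add: cube_embedding_def)

lemma cube_embedding_in_cube: "cube_embedding n m f \<Longrightarrow> S \<in> cube n \<Longrightarrow> f S \<in> cube m"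
  by (auto simp: cube_embedding_def)

text \<open>Adding the elements of \<open>T - S\<close> to \<open>S\<close> one at a time makes the
  image grow strictly each time. Applied to chains through a set, this bounds the layers where its
  image can lie.\<close>

lemma cube_embedding_card_le:
  assumes f: "cube_embedding n m f" and T: "T \<in> cube n" and "S \<subseteq> T"
  shows "card (f S) + card (T - S) \<le> card (f T)"
proof -
  have "finite (T - S)" using cube_finite[OF T] by simp
  have "S \<union> D \<in> cube n \<longrightarrow> card (f S) + card D \<le> card (f (S \<union> D))"
    if "D \<subseteq> T - S" for D
    using finite_subset[OF that \<open>finite (T - S)\<close>] that
  proof (induction D rule: finite_induct)
    case (insert d D)
    have 1: "S \<union> D \<in> cube n" "S \<union> insert d D \<in> cube n"
      using insert.prems \<open>S \<subseteq> T\<close> T by (auto simp: cube_def)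
    have "f (S \<union> D) \<subseteq> f (S \<union> insert d D)"
      using cube_embedding_subset_iff[OF f 1] by blast
    moreover have "\<not> f (S \<union> insert d D) \<subseteq> f (S \<union> D)"
    proof
      assume "f (S \<union> insert d D) \<subseteq> f (S \<union> D)"
      then have "S \<union> insert d D \<subseteq> S \<union> D"
        using cube_embedding_subset_iff[OF f 1(2,1)] by simp
      then show False using insert.prems insert.hyps by blast
    qed
    moreover have "finite (f (S \<union> insert d D))"
      by (rule cube_finite[OF cube_embedding_in_cube[OF f 1(2)]])
    ultimately have "card (f (S \<union> D)) < card (f (S \<union> insert d D))"
      by (simp add: psubset_card_mono subset_not_subset_eq)
    then show ?case using insert.IH insert.prems insert.hyps 1 by simp
  qed simp
  from this[OF order_refl] show ?thesis
    using T \<open>S \<subseteq> T\<close> by (simp add: Un_absorb1 Un_Diff_cancel)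
qed

text \<open>Complementing in both cubes reverses inclusion twice.\<close>

lemma cube_embedding_complement:
  assumes f: "cube_embedding n m f"
  shows "cube_embedding n m (\<lambda>S. {1..m} - f ({1..n} - S))"
proof -
  have sub: "S \<subseteq> T \<longleftrightarrow> {1..m} - f ({1..n} - S) \<subseteq> {1..m} - f ({1..n} - T)"
    if "S \<in> cube n" "T \<in> cube n" for S T
  proof -
    have c: "{1..n} - S \<in> cube n" "{1..n} - T \<in> cube n" by (auto simp: cube_def)
    have "f ({1..n} - T) \<subseteq> {1..m}"
      using cube_embedding_in_cube[OF f c(2)] by (simp add: cube_def)
    then have "{1..m} - f ({1..n} - S) \<subseteq> {1..m} - f ({1..n} - T) \<longleftrightarrow>
        f ({1..n} - T) \<subseteq> f ({1..n} - S)" by blast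
    also have "\<dots> \<longleftrightarrow> {1..n} - T \<subseteq> {1..n} - S"
      by (rule cube_embedding_subset_iff[OF f c(2,1)])
    also have "\<dots> \<longleftrightarrow> S \<subseteq> T" using that by (auto simp: cube_def)
    finally show ?thesis by simp
  qed
  then have "inj_on (\<lambda>S. {1..m} - f ({1..n} - S)) (cube n)"
    by (intro inj_onI) blast
  then show ?thesis
    unfolding cube_embedding_def using sub by (auto simp: cube_def)
qed

section \<open>Copies in a layered colouring\<close>

definition layer_colour :: "nat \<Rightarrow> (nat set \<Rightarrow> bool) \<Rightarrow> nat set \<Rightarrow> bool" where
  "layer_colour n P K \<longleftrightarrow>
     card K \<in> {1..<n} \<or> card K = 2 * n \<or> (card K = n \<and> P K)"

text \<open>Layer \<open>k\<close> goes to layer \<open>2 * n - k\<close>, which swaps the blue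
  layers (value \<open>True\<close>) outside the middle with the red ones; the predicate on the
  middle layer is dualised to match. So red copies reduce to blue ones.\<close>

lemma layer_colour_complement:
  assumes "K \<in> cube (2 * n)" "n \<ge> 1"
  shows "layer_colour n (\<lambda>K. \<not> P ({1..2 * n} - K)) ({1..2 * n} - K) \<longleftrightarrow> \<not> layer_colour n P K"
proof -
  have K: "K \<subseteq> {1..2 * n}" using assms by (simp add: cube_def)
  then have "card K \<le> 2 * n" using card_mono[OF _ K] by simp
  moreover have "card ({1..2 * n} - K) = 2 * n - card K"
    using K by (simp add: card_Diff_subset finite_subset)
  moreover have "{1..2 * n} - ({1..2 * n} - K) = K" using K by blast
  ultimately show ?thesis
    using assms(2) unfolding layer_colour_def by auto
qed

text \<open>The sizes are forced: \<open>f {}\<close> is a singleton \<open>{x}\<close>, atoms go to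
  pairs \<open>{x, y i}\<close>, and the image of the coatom missing \<open>i\<close> is an
  \<open>n\<close>-set containing every other pair, hence equals \<open>Z - {y i}\<close> for
  \<open>Z = {x, y 1, ..., y n}\<close>. The set \<open>Z - {x}\<close> is exempt: every member of
  the copy contains \<open>x\<close>.\<close>

lemma layer_colour_copy:
  assumes f: "cube_embedding n (2 * n) f" and "n \<ge> 2"
    and c: "\<And>S. S \<in> cube n \<Longrightarrow> layer_colour n P (f S)"
  obtains Z x where "Z \<subseteq> {1..2 * n}" "card Z = n + 1"
    "\<And>z. z \<in> Z \<Longrightarrow> z \<noteq> x \<Longrightarrow> P (Z - {z})"
proof -
  let ?C = "\<lambda>i. {1..n} - {i}"
  have cubes: "{} \<in> cube n" "{1..n} \<in> cube n" by (auto simp: cube_def)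
  have sing: "{i} \<in> cube n" "?C i \<in> cube n" if "i \<in> {1..n}" for i
    using that by (auto simp: cube_def)
  have sub: "f S \<subseteq> f T" if "S \<in> cube n" "T \<in> cube n" "S \<subseteq> T" for S T
    using cube_embedding_subset_iff[OF f that(1,2)] that(3) by simp
  have nsub: "S \<subseteq> T" if "S \<in> cube n" "T \<in> cube n" "f S \<subseteq> f T" for S T
    using cube_embedding_subset_iff[OF f that(1,2)] that(3) by simp
  have fin: "finite (f S)" if "S \<in> cube n" for S
    by (rule cube_finite[OF cube_embedding_in_cube[OF f that]])
  have le: "card (f S) \<le> 2 * n" "f S \<subseteq> {1..2 * n}" if "S \<in> cube n" for S
  proof -
    show *: "f S \<subseteq> {1..2 * n}" using cube_embedding_in_cube[OF f that] by (simp add: cube_def)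
    show "card (f S) \<le> 2 * n" using card_mono[OF _ *] by simp
  qed
  have pos: "card (f {}) \<ge> 1"
    using c[OF cubes(1)] \<open>n \<ge> 2\<close> by (auto simp: layer_colour_def)
  \<comment> \<open>A maximal chain through a coatom leaves its image only the sizes from
    \<open>n\<close> to \<open>2 * n - 1\<close>, and among these only size \<open>n\<close> occurs
    in blue.\<close>
  have coatom: "card (f (?C i)) = n" "P (f (?C i))" if i: "i \<in> {1..n}" for i
  proof -
    have "card (f {}) + (n - 1) \<le> card (f (?C i))"
      using cube_embedding_card_le[OF f sing(2)[OF i], of "{}"] i by simp
    moreover have "card (f (?C i)) + 1 \<le> card (f {1..n})"
    proof -
      have "{1..n} - ?C i = {i}" using i by blast
      then show ?thesis
        using cube_embedding_card_le[OF f cubes(2), of "?C i"] by auto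
    qed
    ultimately show "card (f (?C i)) = n" "P (f (?C i))"
      using c[OF sing(2)[OF i]] le(1)[OF cubes(2)] pos \<open>n \<ge> 2\<close>
      by (auto simp: layer_colour_def)
  qed
  have one: "1 \<in> {1..n}" using \<open>n \<ge> 2\<close> by simp
  have "card ({1..n} - {1}) = n - 1" using one by (subst card_Diff_singleton) auto
  then have "card (f {}) + (n - 1) \<le> n"
    using cube_embedding_card_le[OF f sing(2)[OF one], of "{}"] coatom(1)[OF one] by simp
  then have "card (f {}) = 1" using pos \<open>n \<ge> 2\<close> by simp
  then obtain x where x: "f {} = {x}" by (auto simp: card_1_singleton_iff)
  have atom: "\<exists>y. y \<noteq> x \<and> f {i} = {x, y}" if i: "i \<in> {1..n}" for i
  proof -
    \<comment> \<open>The coatom missing \<open>j\<close> lies above \<open>{i}\<close>, and its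
      image has size \<open>n\<close>, so \<open>f {i}\<close> has at most two elements.\<close>
    obtain j where j: "j \<in> {1..n}" "j \<noteq> i"
      using \<open>n \<ge> 2\<close> by (cases "i = 1") (auto intro: that[of 1] that[of 2])
    have "card ({1..n} - {j} - {i}) = n - 2" using i j by simp
    then have "card (f {i}) + (n - 2) \<le> n"
      using cube_embedding_card_le[OF f sing(2)[OF j(1)], of "{i}"] coatom(1)[OF j(1)] i j by simp
    moreover have "card (f {}) + 1 \<le> card (f {i})"
      using cube_embedding_card_le[OF f sing(1)[OF i], of "{}"] by simp
    ultimately have "card (f {i}) = 2" using \<open>card (f {}) = 1\<close> \<open>n \<ge> 2\<close> by simp
    moreover have "x \<in> f {i}" using sub[OF cubes(1) sing(1)[OF i]] x by auto
    ultimately show ?thesis by (auto simp: card_2_iff)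
  qed
  then obtain y where y: "\<And>i. i \<in> {1..n} \<Longrightarrow> y i \<noteq> x \<and> f {i} = {x, y i}"
    by metis
  have inj: "inj_on y {1..n}"
  proof (rule inj_onI)
    fix i j assume ij: "i \<in> {1..n}" "j \<in> {1..n}" "y i = y j"
    then have "f {i} \<subseteq> f {j}" using y by auto
    then show "i = j" using nsub[OF sing(1) sing(1)] ij by blast
  qed
  let ?Z = "insert x (y ` {1..n})"
  have x_notin: "x \<notin> y ` {1..n}" using y by force
  have card_Z: "card ?Z = n + 1"
    using x_notin card_image[OF inj] by simp
  have "P (?Z - {z})" if z: "z \<in> ?Z" "z \<noteq> x" for z
  proof -
    obtain i where i: "i \<in> {1..n}" "z = y i" using z by blast
    have "?Z - {z} \<subseteq> f (?C i)"
    proof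
      fix w assume w: "w \<in> ?Z - {z}"
      then consider "w = x" | j where "j \<in> {1..n}" "w = y j" "j \<noteq> i" using i by blast
      then show "w \<in> f (?C i)"
      proof cases
        case 1
        then show ?thesis using sub[OF cubes(1) sing(2)[OF i(1)]] x by auto
      next
        case 2
        then have "f {j} \<subseteq> f (?C i)" using sing i by (intro sub) auto
        then show ?thesis using y[OF 2(1)] 2 by auto
      qed
    qed
    moreover have "card (?Z - {z}) = n" using z card_Z by (subst card_Diff_singleton) auto
    ultimately have "?Z - {z} = f (?C i)"
      using coatom(1)[OF i(1)] fin[OF sing(2)[OF i(1)]] by (intro card_subset_eq) auto
    then show ?thesis using coatom(2)[OF i(1)] by simp
  qed
  moreover have "?Z \<subseteq> {1..2 * n}"
  proof -
    have "f {i} \<subseteq> {1..2 * n}" if "i \<in> {1..n}" for i using le(2)[OF sing(1)[OF that]] .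
    moreover have "x \<in> f {1}" using y[OF one] by simp
    ultimately show ?thesis using y one by blast
  qed
  ultimately show ?thesis using that[of ?Z x] card_Z by blast
qed

section \<open>Distinct sums in the group Z/n x Z/2\<close>

definition upper_half :: "nat \<Rightarrow> nat \<Rightarrow> int" where
  "upper_half n x = of_bool (x > n)"

text \<open>Group elements are pairs of least nonnegative representatives, so sums are formed in the
  integers and reduced afterwards.\<close>

definition residue :: "nat \<Rightarrow> int \<Rightarrow> int \<Rightarrow> int \<times> int" where
  "residue n a b = (a mod int n, b mod 2)"

text \<open>Two numbers in the same half of \<open>{1..2 * n}\<close> differ by less than
  \<open>n\<close>. The sign serves both deleting a point and adding one.\<close>

lemma residue_weight_inj:
  assumes "\<epsilon> = 1 \<or> \<epsilon> = -1"
  shows "inj_on (\<lambda>z. residue n (a + \<epsilon> * int z) (b + \<epsilon> * upper_half n z)) {1..2 * n}"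
proof (rule inj_onI)
  fix x y assume x: "x \<in> {1..2 * n}" and y: "y \<in> {1..2 * n}"
    and eq: "residue n (a + \<epsilon> * int x) (b + \<epsilon> * upper_half n x)
      = residue n (a + \<epsilon> * int y) (b + \<epsilon> * upper_half n y)"
  have "int n dvd \<epsilon> * int x - \<epsilon> * int y" "2 dvd \<epsilon> * upper_half n x - \<epsilon> * upper_half n y"
    using eq by (simp_all add: residue_def mod_eq_dvd_iff)
  then have 1: "int n dvd int x - int y" and 2: "2 dvd upper_half n x - upper_half n y"
    using assms by (auto simp: dvd_diff_commute)
  have "x > n \<longleftrightarrow> y > n" using 2 by (auto simp: upper_half_def of_bool_def split: if_splits)
  then have "\<bar>int x - int y\<bar> < int n" using x y by auto
  then have "int x - int y = 0" using 1 zdvd_imp_le[of "int n" "\<bar>int x - int y\<bar>"] by fastforce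
  then show "x = y" by simp
qed

text \<open>If all but at most one of the \<open>n + 1\<close> distinct residues of \<open>Z\<close> lie in the \<open>n\<close>-element
  set \<open>A\<close>, they exhaust \<open>A\<close>; summing over \<open>A\<close> then determines the residue of the
  exceptional element.\<close>

lemma two_residues_outside:
  fixes n :: nat and Z :: "nat set" and a b \<epsilon> :: int
  defines "\<phi> \<equiv> \<lambda>z. residue n (a + \<epsilon> * int z) (b + \<epsilon> * upper_half n z)"
  assumes "finite A" "card A = n" and \<epsilon>: "\<epsilon> = 1 \<or> \<epsilon> = -1"
    and Z: "Z \<subseteq> {1..2 * n}" "card Z = n + 1"
    and in_A: "residue n ((int n + 1) * a + \<epsilon> * (\<Sum>z\<in>Z. int z) - (\<Sum>p\<in>A. fst p))
      ((int n + 1) * b + \<epsilon> * (\<Sum>z\<in>Z. upper_half n z) - (\<Sum>p\<in>A. snd p)) \<in> A"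
  shows "\<exists>z\<in>Z. z \<noteq> x \<and> \<phi> z \<notin> A"
proof (rule ccontr)
  assume "\<not> ?thesis"
  then have sub: "\<phi> ` (Z - {x}) \<subseteq> A" by blast
  have finZ: "finite Z" using Z by (simp add: finite_subset)
  have inj: "inj_on \<phi> Z"
    using residue_weight_inj[OF \<epsilon>] Z(1) unfolding \<phi>_def by (rule inj_on_subset)
  have card_im: "card (\<phi> ` D) = card D" if "D \<subseteq> Z" for D
    using that inj by (simp add: card_image inj_on_subset)
  \<comment> \<open>Otherwise \<open>n + 1\<close> distinct residues would lie in the
    \<open>n\<close>-element set \<open>A\<close>.\<close>
  have x: "x \<in> Z"
  proof (rule ccontr)
    assume "x \<notin> Z"
    then have "card (\<phi> ` Z) \<le> card A" using sub \<open>finite A\<close> by (intro card_mono) auto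
    then show False using card_im[of Z] Z \<open>card A = n\<close> by simp
  qed
  have card_x: "card (Z - {x}) = n" using x Z(2) by simp
  have im: "\<phi> ` (Z - {x}) = A"
    using sub card_im[of "Z - {x}"] card_x \<open>finite A\<close> \<open>card A = n\<close> by (intro card_subset_eq) auto
  have reindex: "(\<Sum>p\<in>A. g p) = (\<Sum>z\<in>Z - {x}. g (\<phi> z))" for g :: "_ \<Rightarrow> int"
    unfolding im[symmetric] using inj by (subst sum.reindex) (auto intro: inj_on_subset)
  \<comment> \<open>One coordinate of the argument, with modulus \<open>m\<close>: the residue of
    \<open>x\<close> is the sum over all of \<open>Z\<close> minus the sum over
    \<open>Z - {x}\<close>, and the latter is the sum of \<open>A\<close>.\<close>
  have key: "(c + \<epsilon> * w x) mod m
      = ((int n + 1) * c + \<epsilon> * (\<Sum>z\<in>Z. w z) - (\<Sum>z\<in>Z - {x}. (c + \<epsilon> * w z) mod m)) mod m"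
    for c m :: int and w :: "nat \<Rightarrow> int"
  proof -
    have "((int n + 1) * c + \<epsilon> * (\<Sum>z\<in>Z. w z) - (\<Sum>z\<in>Z - {x}. (c + \<epsilon> * w z) mod m)) mod m
      = ((int n + 1) * c + \<epsilon> * (\<Sum>z\<in>Z. w z) - (\<Sum>z\<in>Z - {x}. c + \<epsilon> * w z)) mod m"
      by (metis mod_diff_right_eq mod_sum_eq)
    also have "(\<Sum>z\<in>Z - {x}. c + \<epsilon> * w z) = int n * c + \<epsilon> * ((\<Sum>z\<in>Z. w z) - w x)"
      using finZ x card_x
      by (simp add: sum.distrib sum_distrib_left[symmetric] sum_diff1)
    finally show ?thesis by (simp add: algebra_simps)
  qed
  \<comment> \<open>The residue of \<open>x\<close> is thus already taken by another element of
    \<open>Z\<close>.\<close>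
  have "\<phi> x \<in> A"
    using in_A key[of a int "int n"] key[of b "upper_half n" 2]
    by (simp add: \<phi>_def reindex residue_def)
  then have "\<phi> x \<in> \<phi> ` (Z - {x})" using im by simp
  then show False using inj x by (auto simp: inj_on_def)
qed

section \<open>The blue residues and their sums\<close>

text \<open>The two sporadic elements are chosen such that the set has sum \<open>(-1, 0)\<close>; for odd \<open>n\<close> it must
  moreover contain both elements over \<open>1\<close> and none over \<open>-1\<close>.\<close>

definition blue_residues :: "nat \<Rightarrow> (int \<times> int) set" where
  "blue_residues n = {1..int n - 2} \<times> {0} \<union>
     (if even n then {(int n - 1, 1), (int n div 2 - 1, 1)} else {(1, 1), (int n - 3, 1)})"

lemma sum_int_interval: "k \<ge> 0 \<Longrightarrow> 2 * (\<Sum>i\<in>{1..k}. i) = k * (k + 1)" for k :: int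
proof (induction k rule: int_ge_induct)
  case (step k)
  have "{1..k + 1} = insert (k + 1) {1..k}" using step by auto
  then show ?case using step by (simp add: algebra_simps)
qed simp

lemma
  assumes n: "n \<ge> 3"
  shows finite_blue_residues: "finite (blue_residues n)"
    and card_blue_residues: "card (blue_residues n) = n"
    and sum_fst_blue_residues: "(\<Sum>p\<in>blue_residues n. fst p) = int n * (int n div 2) - 1"
    and sum_snd_blue_residues: "(\<Sum>p\<in>blue_residues n. snd p) = 2"
proof -
  define p q where "p = (if even n then int n - 1 else 1)"
    and "q = (if even n then int n div 2 - 1 else int n - 3)"
  let ?L = "{1..int n - 2} \<times> {0::int}" and ?U = "{(p, 1), (q, 1::int)}"
  have B: "blue_residues n = ?L \<union> ?U" by (simp add: blue_residues_def p_def q_def)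
  have pq: "p \<noteq> q" using n unfolding p_def q_def by (cases "even n") presburger+
  have disj: "?L \<inter> ?U = {}" by auto
  show "finite (blue_residues n)" by (simp add: B)
  have "card (?L \<union> ?U) = card ?L + card ?U" using disj by (intro card_Un_disjoint) auto
  then show "card (blue_residues n) = n"
    unfolding B using pq n by (simp add: card_cartesian_product)
  have S: "(\<Sum>r\<in>blue_residues n. g r) = (\<Sum>i\<in>{1..int n - 2}. g (i, 0)) + g (p, 1) + g (q, 1)"
    for g :: "_ \<Rightarrow> int"
  proof -
    have "(\<Sum>r\<in>?L. g r) = (\<Sum>i\<in>{1..int n - 2}. g (i, 0))"
      by (subst sum.cartesian_product'[where g = g]) simp
    then show ?thesis unfolding B using disj pq by (subst sum.union_disjoint) auto
  qed
  have "2 * (\<Sum>i\<in>{1..int n - 2}. i) = (int n - 2) * (int n - 1)"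
    using sum_int_interval[of "int n - 2"] n by simp
  \<comment> \<open>Both sums are doubled to keep the triangular number free of division.\<close>
  moreover have "2 * (p + q) = 2 * int n * (int n div 2) - 2 - (int n - 2) * (int n - 1)"
  proof (cases "even n")
    case True
    then obtain k where "n = 2 * k" by blast
    then show ?thesis by (simp add: p_def q_def algebra_simps)
  next
    case False
    then obtain k where "n = 2 * k + 1" by (metis oddE)
    then show ?thesis by (simp add: p_def q_def algebra_simps)
  qed
  ultimately show "(\<Sum>p\<in>blue_residues n. fst p) = int n * (int n div 2) - 1"
    by (simp add: S)
  show "(\<Sum>p\<in>blue_residues n. snd p) = 2" by (simp add: S)
qed

lemma blue_residues_subset:
  assumes "n \<ge> 3"
  shows "blue_residues n \<subseteq> {0..<int n} \<times> {0..<2}"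
  using assms by (auto simp: blue_residues_def)

text \<open>For even \<open>n\<close> the second coordinate is 0 and \<open>(1, 0)\<close> suffices;
  for odd \<open>n\<close> it depends on \<open>b\<close>, so both elements over 1 are
  needed.\<close>

lemma one_in_blue_residues:
  assumes "n \<ge> 3"
  shows "residue n 1 (int n * b) \<in> blue_residues n"
  using assms by (cases "even n") (auto simp: blue_residues_def residue_def mod_2_eq_odd)

text \<open>For even \<open>n\<close> only \<open>(n - 1, 0)\<close> has to be avoided, and
  \<open>(n - 1, 1)\<close> is blue; for odd \<open>n\<close> no blue residue lies over
  \<open>n - 1\<close>.\<close>

lemma minus_one_notin_blue_residues:
  assumes "n \<ge> 3"
  shows "residue n (-1) (int n * b) \<notin> blue_residues n"
proof -
  have "(-1) mod int n = int n - 1" using assms by (simp add: zmod_minus1)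
  then show ?thesis
    using assms by (cases "even n") (auto simp: blue_residues_def residue_def mod_2_eq_odd)
qed

section \<open>Colouring the middle layer by sums\<close>

definition middle_colour :: "nat \<Rightarrow> nat set \<Rightarrow> bool" where
  "middle_colour n K \<longleftrightarrow>
     residue n (\<Sum>x\<in>K. int x) (\<Sum>x\<in>K. upper_half n x) \<in> blue_residues n"

text \<open>Deleting \<open>z\<close> subtracts it from the sum of \<open>Z\<close>, so the sign is
  -1. As the blue residues sum to \<open>(-1, 0)\<close>, the exceptional residue would be
  \<open>(1, n * t)\<close> with \<open>t\<close> the second sum of \<open>Z\<close>, and this is
  blue.\<close>

lemma middle_colour_delete:
  assumes n: "n \<ge> 3" and Z: "Z \<subseteq> {1..2 * n}" "card Z = n + 1"
  shows "\<exists>z\<in>Z. z \<noteq> x \<and> \<not> middle_colour n (Z - {z})"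
proof -
  let ?s = "\<Sum>z\<in>Z. int z" and ?t = "\<Sum>z\<in>Z. upper_half n z"
  have finZ: "finite Z" using Z by (simp add: finite_subset)
  have "residue n ((int n + 1) * ?s + -1 * ?s - (int n * (int n div 2) - 1))
      ((int n + 1) * ?t + -1 * ?t - 2)
    = residue n (1 + int n * (?s - int n div 2)) (int n * ?t + 2 * (-1))"
    by (simp add: algebra_simps)
  also have "\<dots> = residue n 1 (int n * ?t)"
    unfolding residue_def mod_mult_self2 ..
  finally have in_B: "residue n ((int n + 1) * ?s + -1 * ?s - (\<Sum>p\<in>blue_residues n. fst p))
      ((int n + 1) * ?t + -1 * ?t - (\<Sum>p\<in>blue_residues n. snd p)) \<in> blue_residues n"
    using one_in_blue_residues[OF n] n
    by (simp only: sum_fst_blue_residues sum_snd_blue_residues)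
  have "\<exists>z\<in>Z. z \<noteq> x \<and> residue n (?s + -1 * int z) (?t + -1 * upper_half n z) \<notin> blue_residues n"
    by (rule two_residues_outside[OF finite_blue_residues[OF n] card_blue_residues[OF n] _ Z in_B])
      simp
  then obtain z where "z \<in> Z" "z \<noteq> x"
    "residue n (?s - int z) (?t - upper_half n z) \<notin> blue_residues n"
    by auto
  then show ?thesis
    using finZ by (auto simp: middle_colour_def sum_diff1)
qed

text \<open>The complement of \<open>Z - {z}\<close> is that of \<open>Z\<close> with
  \<open>z\<close> added, so the sign is 1 and \<open>A\<close> is the set of red residues. The
  exceptional residue would be \<open>(-1, n * t)\<close> with \<open>t\<close> the second sum of
  the complement of \<open>Z\<close>, and this is red.\<close>

lemma middle_colour_complement_delete:
  assumes n: "n \<ge> 3" and Z: "Z \<subseteq> {1..2 * n}" "card Z = n + 1"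
  shows "\<exists>z\<in>Z. z \<noteq> x \<and> middle_colour n ({1..2 * n} - (Z - {z}))"
proof -
  let ?G = "{0..<int n} \<times> {0..<2::int}"
  let ?A = "?G - blue_residues n"
  let ?s = "\<Sum>z\<in>{1..2 * n} - Z. int z" and ?t = "\<Sum>z\<in>{1..2 * n} - Z. upper_half n z"
  have finZ: "finite Z" using Z by (simp add: finite_subset)
  have cardA: "card ?A = n"
    using n by (simp add: card_Diff_subset finite_blue_residues blue_residues_subset
        card_blue_residues card_cartesian_product)
  have G_fst: "(\<Sum>p\<in>?G. fst p) = int n * (int n - 1)"
  proof -
    have *: "{0..<int n} = insert 0 {1..int n - 1}" using n by auto
    have "(\<Sum>p\<in>?G. fst p) = (\<Sum>i\<in>{0..<int n}. 2 * i)"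
      by (subst sum.cartesian_product') simp
    also have "\<dots> = 2 * (\<Sum>i\<in>{1..int n - 1}. i)"
      unfolding * by (simp add: sum_distrib_left)
    finally show ?thesis using sum_int_interval[of "int n - 1"] n by simp
  qed
  have G_snd: "(\<Sum>p\<in>?G. snd p) = int n"
  proof -
    have "{0..<2::int} = {0, 1}" by auto
    then show ?thesis
      by (subst sum.cartesian_product') simp
  qed
  have total: "?s + (\<Sum>z\<in>Z. int z) = int n * (2 * int n + 1)" "?t + (\<Sum>z\<in>Z. upper_half n z) = int n"
  proof -
    have "?s + (\<Sum>z\<in>Z. int z) = (\<Sum>z\<in>{1..2 * n}. int z)"
      using Z by (intro sum.subset_diff[symmetric]) auto
    also have "\<dots> = int n * (2 * int n + 1)"
      by (induction n) (simp_all add: algebra_simps)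
    finally show "?s + (\<Sum>z\<in>Z. int z) = int n * (2 * int n + 1)" .
    have "?t + (\<Sum>z\<in>Z. upper_half n z) = (\<Sum>z\<in>{1..2 * n}. upper_half n z)"
      using Z by (intro sum.subset_diff[symmetric]) auto
    also have "\<dots> = int (card {z \<in> {1..2 * n}. z > n})"
      by (simp add: upper_half_def of_bool_def sum.If_cases Int_def)
    also have "{z \<in> {1..2 * n}. z > n} = {n<..2 * n}" by auto
    finally show "?t + (\<Sum>z\<in>Z. upper_half n z) = int n" by simp
  qed
  have "residue n ((int n + 1) * ?s + 1 * (\<Sum>z\<in>Z. int z) - (\<Sum>p\<in>?A. fst p))
      ((int n + 1) * ?t + 1 * (\<Sum>z\<in>Z. upper_half n z) - (\<Sum>p\<in>?A. snd p))
    = residue n (-1 + int n * (?s + (2 * int n + 1) - (int n - 1) + int n div 2)) (int n * ?t + 2 * 1)"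
  proof -
    have "(\<Sum>p\<in>?A. fst p) = int n * (int n - 1) - (int n * (int n div 2) - 1)"
      "(\<Sum>p\<in>?A. snd p) = int n - 2"
      using n by (simp_all add: sum_diff blue_residues_subset G_fst G_snd
        sum_fst_blue_residues sum_snd_blue_residues)
    moreover have "(\<Sum>z\<in>Z. int z) = int n * (2 * int n + 1) - ?s"
      "(\<Sum>z\<in>Z. upper_half n z) = int n - ?t" using total by linarith+
    ultimately show ?thesis by (simp only:) (simp add: algebra_simps)
  qed
  also have "\<dots> = residue n (-1) (int n * ?t)"
    unfolding residue_def mod_mult_self2 ..
  also have "\<dots> \<in> ?A"
    using minus_one_notin_blue_residues[OF n] n by (simp add: residue_def)
  finally have in_A: "residue n ((int n + 1) * ?s + 1 * (\<Sum>z\<in>Z. int z) - (\<Sum>p\<in>?A. fst p))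
      ((int n + 1) * ?t + 1 * (\<Sum>z\<in>Z. upper_half n z) - (\<Sum>p\<in>?A. snd p)) \<in> ?A" .
  have "\<exists>z\<in>Z. z \<noteq> x \<and> residue n (?s + 1 * int z) (?t + 1 * upper_half n z) \<notin> ?A"
    by (rule two_residues_outside[OF _ cardA _ Z in_A]) simp_all
  then obtain z where z: "z \<in> Z" "z \<noteq> x"
    and r: "residue n (?s + int z) (?t + upper_half n z) \<notin> ?A"
    unfolding mult_1 by blast
  have "{1..2 * n} - (Z - {z}) = insert z ({1..2 * n} - Z)" using z Z by auto
  then show ?thesis
    \<comment> \<open>Every residue lies in the full group, so one outside \<open>?A\<close> is
      blue.\<close>
    using z r n by (auto simp: middle_colour_def residue_def add.commute)
qed

section \<open>The colouring of the cube and the lower bound\<close>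

lemma no_monochromatic_copy:
  assumes n: "n \<ge> 3" and copy: "cube_copy n (2 * n) C"
  shows "\<not> monochromatic (layer_colour n (middle_colour n)) C"
proof
  let ?c = "layer_colour n (middle_colour n)"
  assume "monochromatic ?c C"
  then obtain f b where f: "cube_embedding n (2 * n) f" and b: "\<And>S. S \<in> cube n \<Longrightarrow> ?c (f S) = b"
    using copy by (auto simp: monochromatic_def cube_copy_def)
  show False
  proof (cases b)
    case True
    have "2 \<le> n" using n by simp
    from f this b[unfolded eqTrueI[OF True] simp_thms] obtain Z x where "Z \<subseteq> {1..2 * n}" "card Z = n + 1"
      "\<And>z. z \<in> Z \<Longrightarrow> z \<noteq> x \<Longrightarrow> middle_colour n (Z - {z})"
      by (rule layer_colour_copy) auto
    then show False using middle_colour_delete[OF n] by blast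
  next
    case False
    let ?g = "\<lambda>S. {1..2 * n} - f ({1..n} - S)"
    let ?P = "\<lambda>K. \<not> middle_colour n ({1..2 * n} - K)"
    have g: "layer_colour n ?P (?g S)" if "S \<in> cube n" for S
    proof -
      have S: "{1..n} - S \<in> cube n" by (auto simp: cube_def)
      then have "f ({1..n} - S) \<in> cube (2 * n)" by (rule cube_embedding_in_cube[OF f])
      then show ?thesis
        using b[OF S] False n by (subst layer_colour_complement) auto
    qed
    have "2 \<le> n" using n by simp
    from cube_embedding_complement[OF f] this g obtain Z x where "Z \<subseteq> {1..2 * n}" "card Z = n + 1"
      "\<And>z. z \<in> Z \<Longrightarrow> z \<noteq> x \<Longrightarrow> ?P (Z - {z})"
      by (rule layer_colour_copy) auto
    then show False using middle_colour_complement_delete[OF n] by blast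
  qed
qed

lemma cube_arrows_mono:
  assumes "cube_arrows m n" "m \<le> m'"
  shows "cube_arrows m' n"
proof -
  have "cube m \<subseteq> cube m'" using assms(2) by (auto simp: cube_def)
  then have "cube_copy n m C \<Longrightarrow> cube_copy n m' C" for C
    by (fastforce simp: cube_copy_def cube_embedding_def)
  then show ?thesis using assms(1) unfolding cube_arrows_def by blast
qed

theorem theorem1:
  fixes n :: nat
  assumes "n \<ge> 3"
  shows "cube_ramsey n \<ge> 2 * n + 1 \<and>
    (\<exists>c :: nat set \<Rightarrow> bool. \<nexists>C. cube_copy n (2 * n) C \<and> monochromatic c C)"
proof -
  have colouring: "\<nexists>C. cube_copy n (2 * n) C \<and> monochromatic (layer_colour n (middle_colour n)) C"
    using no_monochromatic_copy[OF assms] by blast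
  then have "\<not> cube_arrows (2 * n) n" by (auto simp: cube_arrows_def)
  \<comment> \<open>The least value is attained because \<open>cube_arrows_block\<close> supplies
    some valid dimension; monotonicity then excludes values up to \<open>2 * n\<close>.\<close>
  moreover have "cube_arrows (cube_ramsey n) n"
    unfolding cube_ramsey_def using cube_arrows_block by (rule LeastI)
  ultimately have "\<not> cube_ramsey n \<le> 2 * n" using cube_arrows_mono by blast
  then show ?thesis using colouring by auto
qed

end
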